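(* Let $\underline Q$ be an arbitrary lower transition rate operator and let $L_t^s$ ($0\le t\le s$) be the lower transition operators corresponding to $\underline Q$. Then for all $t,r,s\in\mathbb R_{\ge0}$ such that $t\le r\le s$, $$L_t^s=L_t^rL_r^s .$$ Furthermore, for all $t\in\mathbb R_{\ge0}$, $L_t^t=I$.
   Context: $\mathcal X$ is a fixed finite non-empty set; $\mathcal L(\mathcal X)$ is the set of all $f:\mathcal X\to\mathbb R$, with $\|f\|=\max_x|f(x)|$; inequalities between functions are pointwise. A non-negatively homogeneous operator $A:\mathcal L(\mathcal X)\to\mathcal L(\mathcal X)$ has norm $\|A\|=\sup\{\|Af\|:\|f\|=1\}$. $I$ is the identity. A lower transition rate operator is a map $\underline Q:\mathcal L(\mathcal X)\to\mathcal L(\mathcal X)$ such that for all $f,g\in\mathcal L(\mathcal X)$, $\lambda\ge0$, constant functions $\mu$ and $x,y\in\mathcal X$: $[\underline Q\mu](x)=0$; $[\underline Q\mathbb I_y](x)\ge0$ if $x\ne y$; $\underline Q(f+g)\ge\underline Qf+\underline Qg$; $\underline Q(\lambda f)=\lambda\underline Qf$. A lower transition operator is a map $\underline T:\mathcal L(\mathcal X)\to\mathcal L(\mathcal X)$ with $[\underline Tf](x)\ge\min f$, $\underline T(f+g)\ge\underline Tf+\underline Tg$ and $\underline T(\lambda f)=\lambda\underline Tf$ for $\lambda\ge0$. For $t\le s$, $\mathcal U_{[t,s]}$ is the set of finite sequences $u:\ t=t_0<t_1<\dots<t_n=s$; $\Delta_i=t_i-t_{i-1}$, $\sigma(u)=\max_i\Delta_i$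 ($0$ if $n=0$), $\Phi_u=(I+\Delta_1\underline Q)\cdots(I+\Delta_n\underline Q)$ (composition; $I$ if $n=0$). The lower transition operator $L_t^s$ corresponding to $\underline Q$ is the (existing, unique) lower transition operator such that for every $\epsilon>0$ there is $\delta>0$ with $\|L_t^s-\Phi_u\|\le\epsilon$ for all $u\in\mathcal U_{[t,s]}$ with $\sigma(u)\le\delta$. *)

theory Defs
  imports "HOL-Analysis.Analysis"
begin

text \<open>
  The finite non-empty state space is a type of class \<open>finite\<close>, so that
  \<open>'x \<Rightarrow> real\<close> is the set of all real-valued functions on it. The maximum norm is defined
  here because this function space carries no library norm; the pointwise order on it is
  the library's order on functions.
\<close>

type_synonym 'x operator = "('x \<Rightarrow> real) \<Rightarrow> ('x \<Rightarrow> real)"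

definition max_norm :: "('x::finite \<Rightarrow> real) \<Rightarrow> real" where
  "max_norm f = Max (range (\<lambda>x. \<bar>f x\<bar>))"

text \<open>
  The supremum is taken in the extended reals, so that it is meaningful whether or not
  the operator is bounded.
\<close>

definition operator_norm :: "'x::finite operator \<Rightarrow> ereal" where
  "operator_norm A = (SUP f\<in>{f. max_norm f = 1}. ereal (max_norm (A f)))"

definition lower_transition_rate_operator :: "'x::finite operator \<Rightarrow> bool" where
  "lower_transition_rate_operator Q \<longleftrightarrow>
     (\<forall>c x. Q (\<lambda>_. c) x = 0) \<and>
     (\<forall>x y. x \<noteq> y \<longrightarrow> 0 \<le> Q (indicator {y}) x) \<and>
     (\<forall>f g. (\<lambda>x. Q f x + Q g x) \<le> Q (\<lambda>x. f x + g x)) \<and>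
     (\<forall>c f. 0 \<le> c \<longrightarrow> Q (\<lambda>x. c * f x) = (\<lambda>x. c * Q f x))"

definition lower_transition_operator :: "'x::finite operator \<Rightarrow> bool" where
  "lower_transition_operator T \<longleftrightarrow>
     (\<forall>f x. Min (range f) \<le> T f x) \<and>
     (\<forall>f g. (\<lambda>x. T f x + T g x) \<le> T (\<lambda>x. f x + g x)) \<and>
     (\<forall>c f. 0 \<le> c \<longrightarrow> T (\<lambda>x. c * f x) = (\<lambda>x. c * T f x))"

text \<open>
  A subdivision \<open>t = t\<^sub>0 < \<dots> < t\<^sub>n = s\<close> is the list \<open>[t\<^sub>0, \<dots>, t\<^sub>n]\<close>. Its list of increments
  \<open>[t\<^sub>1 - t\<^sub>0, \<dots>, t\<^sub>n - t\<^sub>n\<^sub>-\<^sub>1]\<close> is empty exactly when \<open>n = 0\<close>.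
\<close>

definition subdivisions :: "real \<Rightarrow> real \<Rightarrow> real list set" where
  "subdivisions t s = {u. u \<noteq> [] \<and> sorted_wrt (<) u \<and> hd u = t \<and> last u = s}"

definition increments :: "real list \<Rightarrow> real list" where
  "increments u = map2 (-) (tl u) u"

text \<open>
  Increments of a subdivision are positive, so inserting \<open>0\<close> only affects the case \<open>n = 0\<close>.
\<close>

definition mesh :: "real list \<Rightarrow> real" where
  "mesh u = Max (insert 0 (set (increments u)))"

definition Euler_step :: "'x operator \<Rightarrow> real \<Rightarrow> 'x operator" where
  "Euler_step Q d = (\<lambda>f x. f x + d * Q f x)"

definition Euler_product :: "'x operator \<Rightarrow> real list \<Rightarrow> 'x operator" where
  "Euler_product Q u = foldr (\<lambda>d A. Euler_step Q d \<circ> A) (increments u) id"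

definition corresponds :: "'x::finite operator \<Rightarrow> real \<Rightarrow> real \<Rightarrow> 'x operator \<Rightarrow> bool" where
  "corresponds Q t s T \<longleftrightarrow>
     lower_transition_operator T \<and>
     (\<forall>\<epsilon>>0. \<exists>\<delta>>0. \<forall>u\<in>subdivisions t s. mesh u \<le> \<delta> \<longrightarrow>
        operator_norm (\<lambda>f x. T f x - Euler_product Q u f x) \<le> ereal \<epsilon>)"

text \<open>
  \<open>lower_transition Q t s\<close> is the operator \<open>L\<^sub>t\<^sup>s\<close> corresponding to \<open>Q\<close>; the description is
  proper when \<open>Q\<close> is a lower transition rate operator and \<open>t \<le> s\<close>.
\<close>

definition lower_transition :: "'x::finite operator \<Rightarrow> real \<Rightarrow> real \<Rightarrow> 'x operator" where
  "lower_transition Q t s = (THE T. corresponds Q t s T)"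

end

theory Submission
  imports Defs
begin

text \<open>
  For steps of length at most \<open>1 / K\<close>, where \<open>K\<close> is a Lipschitz constant of \<open>Q\<close>, the factors
  \<open>I + \<Delta> Q\<close> are lower transition operators and hence nonexpansive. Subdividing a single step of
  length \<open>\<Delta>\<close> changes the product by at most \<open>K\<^sup>2 \<Delta>\<^sup>2\<close>, so refining a subdivision of \<open>[t, s]\<close>
  changes the product by at most \<open>K\<^sup>2 (s - t)\<close> times its mesh. Two subdivisions are compared through
  their common refinement; the products therefore form a Cauchy net, and its limit is the
  corresponding operator. The semigroup property passes to the limit along subdivisions that
  contain the intermediate point.
\<close>

section \<open>The maximum norm\<close>

lemma abs_le_max_norm: "\<bar>f x\<bar> \<le> max_norm f"
  unfolding max_norm_def by (rule Max_ge) auto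

lemma max_norm_le_iff: "max_norm f \<le> c \<longleftrightarrow> (\<forall>x. \<bar>f x\<bar> \<le> c)"
  unfolding max_norm_def by (subst Max_le_iff) auto

lemma max_norm_nonneg: "0 \<le> max_norm f"
  using abs_le_max_norm[of f undefined] by linarith

lemma max_norm_const [simp]: "max_norm (\<lambda>_. c) = \<bar>c\<bar>"
  by (simp add: max_norm_def)

lemma max_norm_minus_commute: "max_norm (\<lambda>x. f x - g x) = max_norm (\<lambda>x. g x - f x)"
  by (simp add: max_norm_def abs_minus_commute)

lemma max_norm_add_le: "max_norm (\<lambda>x. f x + g x) \<le> max_norm f + max_norm g"
  unfolding max_norm_le_iff using abs_le_max_norm[of f] abs_le_max_norm[of g]
  by (intro allI order_trans[OF abs_triangle_ineq] add_mono) auto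

lemma max_norm_triangle:
  "max_norm (\<lambda>x. f x - h x) \<le> max_norm (\<lambda>x. f x - g x) + max_norm (\<lambda>x. g x - h x)"
  using max_norm_add_le[of "\<lambda>x. f x - g x" "\<lambda>x. g x - h x"] by simp

lemma max_norm_scale: "max_norm (\<lambda>x. c * f x) = \<bar>c\<bar> * max_norm f"
proof (rule antisym)
  show "max_norm (\<lambda>x. c * f x) \<le> \<bar>c\<bar> * max_norm f"
    unfolding max_norm_le_iff by (simp add: abs_mult abs_le_max_norm mult_left_mono)
  have "max_norm f \<in> range (\<lambda>x. \<bar>f x\<bar>)"
    unfolding max_norm_def by (rule Max_in) auto
  then obtain x where "max_norm f = \<bar>f x\<bar>"
    by blast
  then show "\<bar>c\<bar> * max_norm f \<le> max_norm (\<lambda>x. c * f x)"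
    using abs_le_max_norm[of "\<lambda>x. c * f x" x] by (simp add: abs_mult)
qed

lemma max_norm_eq_0_iff: "max_norm f = 0 \<longleftrightarrow> f = (\<lambda>_. 0)"
  by (metis abs_le_max_norm abs_le_zero_iff abs_zero ext max_norm_const)

text \<open>Homogeneity rescales a nonzero \<open>f\<close> to norm one, and the factor 0 gives
  \<open>A 0 = 0\<close>. This replaces the extended-real supremum by a real inequality for each
  function, the form in which all later estimates are made.\<close>

lemma operator_norm_le_iff:
  assumes hom: "\<And>c f. 0 \<le> c \<Longrightarrow> A (\<lambda>x. c * f x) = (\<lambda>x. c * A f x)"
  shows "operator_norm A \<le> ereal e \<longleftrightarrow> (\<forall>f. max_norm (A f) \<le> e * max_norm f)"
proof
  assume "operator_norm A \<le> ereal e"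
  then have unit: "max_norm (A g) \<le> e" if "max_norm g = 1" for g
    using that unfolding operator_norm_def SUP_le_iff by auto
  show "\<forall>f. max_norm (A f) \<le> e * max_norm f"
  proof
    fix f
    show "max_norm (A f) \<le> e * max_norm f"
    proof (cases "max_norm f = 0")
      case True
      then have "f = (\<lambda>_. 0)"
        by (simp add: max_norm_eq_0_iff)
      moreover have "A (\<lambda>_. 0) = (\<lambda>_. 0)"
        using hom[of 0 f] by simp
      ultimately show ?thesis
        by simp
    next
      case False
      define m where "m = max_norm f"
      then have m: "m > 0"
        using False max_norm_nonneg[of f] by linarith
      define g where "g = (\<lambda>x. inverse m * f x)"
      have "max_norm g = 1"
        unfolding g_def using m by (simp add: max_norm_scale m_def[symmetric])
      moreover have "f = (\<lambda>x. m * g x)"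
        using m by (simp add: g_def fun_eq_iff)
      then have "max_norm (A f) = m * max_norm (A g)"
        using hom[of m g] m by (simp add: max_norm_scale)
      ultimately show ?thesis
        using unit[of g] m by (simp add: m_def[symmetric] mult.commute)
    qed
  qed
next
  assume "\<forall>f. max_norm (A f) \<le> e * max_norm f"
  then show "operator_norm A \<le> ereal e"
    unfolding operator_norm_def SUP_le_iff by (metis ereal_less_eq(3) mem_Collect_eq mult.right_neutral)
qed

section \<open>Lower transition operators\<close>

lemma lower_transition_operator_superadditive:
  "lower_transition_operator T \<Longrightarrow> T f x + T g x \<le> T (\<lambda>x. f x + g x) x"
  by (simp add: lower_transition_operator_def le_fun_def)

lemma lower_transition_operator_homogeneous:
  "lower_transition_operator T \<Longrightarrow> 0 \<le> c \<Longrightarrow> T (\<lambda>x. c * f x) = (\<lambda>x. c * T f x)"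
  by (simp add: lower_transition_operator_def)

lemma lower_transition_operator_ge:
  assumes "lower_transition_operator T" "\<And>y. c \<le> f y"
  shows "c \<le> T f x"
proof -
  have "c \<le> Min (range f)"
    using assms(2) by simp
  also have "\<dots> \<le> T f x"
    using assms(1) unfolding lower_transition_operator_def by blast
  finally show ?thesis .
qed

text \<open>Write \<open>f = g + (f - g)\<close>: superadditivity bounds \<open>T f - T g\<close>
  below by \<open>T (f - g)\<close>, which is at least \<open>c\<close>. The case
  \<open>c = 0\<close> is monotonicity.\<close>

lemma lower_transition_operator_diff:
  assumes "lower_transition_operator T" "\<And>y. c \<le> f y - g y"
  shows "c \<le> T f x - T g x"
  using lower_transition_operator_ge[OF assms(1), of c "\<lambda>y. f y - g y" x]
    lower_transition_operator_superadditive[OF assms(1), of g x "\<lambda>y. f y - g y"] assms(2)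
  by simp

lemma lower_transition_operator_nonexpansive:
  assumes "lower_transition_operator T"
  shows "max_norm (\<lambda>x. T f x - T g x) \<le> max_norm (\<lambda>x. f x - g x)"
  unfolding max_norm_le_iff
proof
  fix x
  have *: "- max_norm (\<lambda>x. f x - g x) \<le> f y - g y" "- max_norm (\<lambda>x. f x - g x) \<le> g y - f y" for y
    using abs_le_max_norm[of "\<lambda>x. f x - g x" y] by linarith+
  have "- max_norm (\<lambda>x. f x - g x) \<le> T f x - T g x"
    by (rule lower_transition_operator_diff[OF assms]) (rule *)
  moreover have "- max_norm (\<lambda>x. f x - g x) \<le> T g x - T f x"
    by (rule lower_transition_operator_diff[OF assms]) (rule *)
  ultimately show "\<bar>T f x - T g x\<bar> \<le> max_norm (\<lambda>x. f x - g x)"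
    by linarith
qed

lemma lower_transition_operator_max_norm_le:
  assumes "lower_transition_operator T"
  shows "max_norm (T f) \<le> max_norm f"
proof -
  have "T (\<lambda>_. 0) = (\<lambda>_. 0)"
    using lower_transition_operator_homogeneous[OF assms, of 0 f] by simp
  then show ?thesis
    using lower_transition_operator_nonexpansive[OF assms, of f "\<lambda>_. 0"] by simp
qed

lemma lower_transition_operator_id: "lower_transition_operator id"
  by (simp add: lower_transition_operator_def)

lemma lower_transition_operator_comp:
  assumes S: "lower_transition_operator S" and T: "lower_transition_operator T"
  shows "lower_transition_operator (S \<circ> T)"
  unfolding lower_transition_operator_def le_fun_def comp_apply
proof (intro conjI allI impI)
  fix f g :: "'a \<Rightarrow> real" and x
  show "Min (range f) \<le> S (T f) x"
    by (intro lower_transition_operator_ge[OF S] lower_transition_operator_ge[OF T]) simp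
  \<comment> \<open>Monotonicity of \<open>S\<close> carries the superadditivity of \<open>T\<close>
    through the outer operator.\<close>
  have "0 \<le> S (T (\<lambda>x. f x + g x)) x - S (\<lambda>x. T f x + T g x) x"
    by (rule lower_transition_operator_diff[OF S])
      (simp add: lower_transition_operator_superadditive[OF T])
  then show "S (T f) x + S (T g) x \<le> S (T (\<lambda>x. f x + g x)) x"
    using lower_transition_operator_superadditive[OF S, of "T f" x "T g"] by simp
next
  fix c :: real and f :: "'a \<Rightarrow> real"
  assume "0 \<le> c"
  then show "S (T (\<lambda>x. c * f x)) = (\<lambda>x. c * S (T f) x)"
    by (simp add: lower_transition_operator_homogeneous[OF S]
        lower_transition_operator_homogeneous[OF T])
qed

section \<open>Subdivisions\<close>

lemma subdivisions_single: "[t] \<in> subdivisions t t"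
  by (simp add: subdivisions_def)

lemma subdivisions_Cons:
  assumes "t < r" "u \<in> subdivisions r s"
  shows "t # u \<in> subdivisions t s"
  using assms by (cases u) (auto simp: subdivisions_def)

text \<open>Peels off the leftmost point while the right endpoint stays fixed. This matches the
  Euler product, whose first increment gives the outermost factor.\<close>

lemma subdivisions_induct [consumes 1, case_names single step]:
  assumes "u \<in> subdivisions t s"
    and "P s [s]"
    and "\<And>t r u. t < r \<Longrightarrow> u \<in> subdivisions r s \<Longrightarrow> P r u \<Longrightarrow> P t (t # u)"
  shows "P t u"
  using assms(1)
proof (induction u arbitrary: t)
  case Nil
  then show ?case
    by (simp add: subdivisions_def)
next
  case (Cons a u)
  show ?case
  proof (cases u)
    case Nil
    then show ?thesis
      using Cons.prems assms(2) by (auto simp: subdivisions_def)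
  next
    case (Cons b v)
    then have "a = t" "t < b" "u \<in> subdivisions b s"
      using Cons.prems by (auto simp: subdivisions_def)
    then show ?thesis
      using assms(3) Cons.IH by blast
  qed
qed

lemma subdivisions_le: "u \<in> subdivisions t s \<Longrightarrow> t \<le> s"
  by (induction rule: subdivisions_induct) auto

lemma subdivisions_set: "u \<in> subdivisions t s \<Longrightarrow> set u \<subseteq> {t..s} \<and> t \<in> set u \<and> s \<in> set u"
proof (induction rule: subdivisions_induct)
  case (step t r u)
  then have "t \<le> s" "{r..s} \<subseteq> {t..s}"
    using subdivisions_le[OF step.hyps(2)] by auto
  then show ?case
    using step.IH by auto
qed auto

lemma subdivisions_same: "u \<in> subdivisions t t \<longleftrightarrow> u = [t]"
proof
  assume u: "u \<in> subdivisions t t"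
  have "u = [a] \<or> a < b" if "u \<in> subdivisions a b" for a b
    using that by (induction rule: subdivisions_induct) (auto dest: subdivisions_le)
  then show "u = [t]"
    using u by blast
qed (simp add: subdivisions_single)

lemma mesh_single [simp]: "mesh [t] = 0"
  by (simp add: mesh_def increments_def)

lemma mesh_Cons: "u \<in> subdivisions r s \<Longrightarrow> mesh (t # u) = max (r - t) (mesh u)"
proof -
  assume "u \<in> subdivisions r s"
  then have *: "set (increments (t # u)) = insert (r - t) (set (increments u))"
    by (cases u) (auto simp: subdivisions_def increments_def)
  \<comment> \<open>After the inserts are swapped, \<open>r - t\<close> is split off from a set that
    still contains 0, so the maximum is well defined even when \<open>u\<close> is a single
    point.\<close>
  show ?thesis
    unfolding mesh_def * by (subst insert_commute, subst Max_insert) auto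
qed

lemma mesh_nonneg: "0 \<le> mesh u"
  by (simp add: mesh_def)

lemma mesh_le_length: "u \<in> subdivisions t s \<Longrightarrow> mesh u \<le> s - t"
proof (induction rule: subdivisions_induct)
  case (step t r u)
  then show ?case
    using subdivisions_le[OF step.hyps(2)] by (simp add: mesh_Cons[OF step.hyps(2)])
qed simp

lemma Euler_product_single [simp]: "Euler_product Q [t] = id"
  by (simp add: Euler_product_def increments_def)

lemma Euler_product_Cons:
  "u \<in> subdivisions r s \<Longrightarrow> Euler_product Q (t # u) = Euler_step Q (r - t) \<circ> Euler_product Q u"
  by (cases u) (auto simp: subdivisions_def Euler_product_def increments_def)

text \<open>The point \<open>r\<close> ends \<open>u\<close> and begins \<open>v\<close>;
  \<open>butlast\<close> removes the duplicate.\<close>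

lemma subdivisions_join:
  assumes "u \<in> subdivisions t r" "v \<in> subdivisions r s"
  shows "butlast u @ v \<in> subdivisions t s"
    and "mesh (butlast u @ v) = max (mesh u) (mesh v)"
    and "Euler_product Q (butlast u @ v) = Euler_product Q u \<circ> Euler_product Q v"
proof -
  have "butlast u @ v \<in> subdivisions t s \<and> mesh (butlast u @ v) = max (mesh u) (mesh v) \<and>
    Euler_product Q (butlast u @ v) = Euler_product Q u \<circ> Euler_product Q v"
    using assms(1)
  proof (induction rule: subdivisions_induct)
    case single
    then show ?case
      using assms(2) by (simp add: mesh_nonneg)
  next
    case (step t q u)
    then have *: "butlast (t # u) @ v = t # (butlast u @ v)"
      by (auto simp: subdivisions_def)
    have join: "butlast u @ v \<in> subdivisions q s"
      using step.IH by blast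
    show ?case
      unfolding * mesh_Cons[OF step.hyps(2)] mesh_Cons[OF join]
        Euler_product_Cons[OF step.hyps(2)] Euler_product_Cons[OF join]
      using step.IH subdivisions_Cons[OF step.hyps(1) join] by (metis comp_assoc max.assoc)
  qed
  then show "butlast u @ v \<in> subdivisions t s"
    "mesh (butlast u @ v) = max (mesh u) (mesh v)"
    "Euler_product Q (butlast u @ v) = Euler_product Q u \<circ> Euler_product Q v"
    by auto
qed

text \<open>Converse of joining. The set equation ensures that a subdivision of
  \<open>[r, s]\<close> whose points all lie in \<open>w\<close> is refined by the right part
  \<open>w2\<close>, as the induction over refinements requires.\<close>

lemma subdivisions_split:
  assumes "w \<in> subdivisions t s" "r \<in> set w"
  obtains w1 w2 where "w1 \<in> subdivisions t r" "w2 \<in> subdivisions r s" "w = butlast w1 @ w2"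
    "{x \<in> set w. r \<le> x} = set w2"
proof -
  have "\<exists>w1\<in>subdivisions t r. \<exists>w2\<in>subdivisions r s.
      w = butlast w1 @ w2 \<and> {x \<in> set w. r \<le> x} = set w2"
    using assms
  proof (induction rule: subdivisions_induct)
    case single
    then show ?case
      by (intro bexI[of _ "[s]"]) (auto simp: subdivisions_single)
  next
    case (step t q u)
    show ?case
    proof (cases "r = t")
      case True
      have "{x \<in> set (t # u). t \<le> x} = set (t # u)"
        using subdivisions_set[OF step.hyps(2)] step.hyps(1) by force
      then show ?thesis
        using True subdivisions_Cons[OF step.hyps]
        by (intro bexI[of _ "[t]"] bexI[of _ "t # u"]) (auto simp: subdivisions_single)
    next
      case False
      then obtain w1 w2 where w: "w1 \<in> subdivisions q r" "w2 \<in> subdivisions r s"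
        "u = butlast w1 @ w2" "{x \<in> set u. r \<le> x} = set w2"
        using step by auto
      have "q \<le> r"
        using w(1) by (rule subdivisions_le)
      then have "{x \<in> set (t # u). r \<le> x} = set w2"
        using w(4) step.hyps(1) by auto
      moreover have "t # u = butlast (t # w1) @ w2"
        using w by (auto simp: subdivisions_def)
      ultimately show ?thesis
        using subdivisions_Cons[OF step.hyps(1) w(1)] w(2) by blast
    qed
  qed
  then show thesis
    using that by blast
qed

lemma subdivisions_common_refinement:
  assumes "u \<in> subdivisions t s" "v \<in> subdivisions t s"
  obtains w where "w \<in> subdivisions t s" "set u \<subseteq> set w" "set v \<subseteq> set w"
proof
  define w where "w = sorted_list_of_set (set u \<union> set v)"
  have set_w: "set w = set u \<union> set v" and sorted_w: "sorted_wrt (<) w"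
    by (simp_all add: w_def)
  then show "set u \<subseteq> set w" "set v \<subseteq> set w"
    by auto
  have bounds: "set w \<subseteq> {t..s}" "t \<in> set w" "s \<in> set w"
    using subdivisions_set[OF assms(1)] subdivisions_set[OF assms(2)] set_w by auto
  then have "w \<noteq> []"
    by auto
  have "hd w \<le> t"
    using bounds(2) sorted_w by (cases w) auto
  moreover have "s \<le> last w"
    using bounds(3) sorted_w by (cases w rule: rev_cases) (auto simp: sorted_wrt_append)
  moreover have "hd w \<in> {t..s}" "last w \<in> {t..s}"
    using bounds(1) hd_in_set[OF \<open>w \<noteq> []\<close>] last_in_set[OF \<open>w \<noteq> []\<close>] by blast+
  ultimately show "w \<in> subdivisions t s"
    using \<open>w \<noteq> []\<close> sorted_w by (auto simp: subdivisions_def)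
qed

lemma subdivisions_fine:
  assumes "t \<le> s" "\<delta> > 0"
  obtains u where "u \<in> subdivisions t s" "mesh u \<le> \<delta>"
proof -
  \<comment> \<open>Induction on the number of steps of length \<delta> that cover the interval,
    with \<open>t\<close> moving to the right. The last step may be shorter, and
    \<open>n = 0\<close> forces \<open>t = s\<close>.\<close>
  have "\<exists>u\<in>subdivisions t s. mesh u \<le> \<delta>" if "t \<le> s" "s - t \<le> real n * \<delta>" for n t
    using that
  proof (induction n arbitrary: t)
    case 0
    then show ?case
      using assms(2) by (auto intro!: bexI[of _ "[t]"] simp: subdivisions_single)
  next
    case (Suc n)
    show ?case
    proof (cases "t + \<delta> \<le> s")
      case True
      moreover have "s - (t + \<delta>) \<le> real n * \<delta>"
        using Suc.prems by (simp add: algebra_simps)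
      ultimately obtain u where "u \<in> subdivisions (t + \<delta>) s" "mesh u \<le> \<delta>"
        using Suc.IH by blast
      then show ?thesis
        using assms(2) subdivisions_Cons[of t "t + \<delta>" u s]
        by (intro bexI[of _ "t # u"]) (auto simp: mesh_Cons)
    next
      case False
      show ?thesis
      proof (cases "t = s")
        case True
        then show ?thesis
          using assms(2) by (auto intro!: bexI[of _ "[t]"] simp: subdivisions_single)
      next
        case neq: False
        then have "[t, s] \<in> subdivisions t s"
          using Suc.prems by (simp add: subdivisions_def)
        then show ?thesis
          using mesh_le_length[of "[t, s]" t s] False by (intro bexI[of _ "[t, s]"]) auto
      qed
    qed
  qed
  moreover obtain n where "s - t \<le> real n * \<delta>"
    using assms(2) ex_less_of_nat_mult less_imp_le by metis
  ultimately show thesis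
    using assms(1) that by blast
qed

section \<open>Lower transition rate operators\<close>

text \<open>Superadditivity extends to finite sums, here to the decomposition of \<open>f\<close>
  into multiples of indicators. Lower bounds on \<open>Q\<close> thus reduce to its values on
  those.\<close>

lemma lower_transition_rate_operator_indicator_sum:
  assumes "lower_transition_rate_operator Q"
  shows "(\<Sum>y\<in>UNIV. Q (\<lambda>z. f y * indicator {y} z) x) \<le> Q f x"
proof -
  have zero: "Q (\<lambda>_. 0) x = 0"
    using assms by (simp add: lower_transition_rate_operator_def)
  have super: "Q g x + Q h x \<le> Q (\<lambda>x. g x + h x) x" for g h
    using assms by (simp add: lower_transition_rate_operator_def le_fun_def)
  have "(\<Sum>y\<in>S. Q (F y) x) \<le> Q (\<lambda>z. \<Sum>y\<in>S. F y z) x"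
    if "finite S" for S and F :: "'a \<Rightarrow> 'a \<Rightarrow> real"
    using that
  proof induction
    case empty
    then show ?case
      by (simp add: zero)
  next
    case (insert y S)
    then show ?case
      using super[of "F y" "\<lambda>z. \<Sum>y\<in>S. F y z"] by simp
  qed
  from this[of UNIV "\<lambda>y z. f y * indicator {y} z"]
  show ?thesis
    by (simp add: indicator_def)
qed

text \<open>Superadditivity gives \<open>Q (f - g) \<le> Q f - Q g\<close>, and the same with
  \<open>f\<close> and \<open>g\<close> exchanged, so a lower bound on \<open>Q h\<close>
  proportional to the norm of \<open>h\<close> suffices.\<close>

lemma lower_transition_rate_operator_lipschitz:
  assumes "lower_transition_rate_operator Q"
  obtains K where "K > 0"
    "\<And>f g. max_norm (\<lambda>x. Q f x - Q g x) \<le> K * max_norm (\<lambda>x. f x - g x)"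
proof
  have hom: "Q (\<lambda>x. c * f x) x = c * Q f x" if "0 \<le> c" for c f x
    using assms that by (simp add: lower_transition_rate_operator_def)
  have super: "Q g x + Q h x \<le> Q (\<lambda>x. g x + h x) x" for g h x
    using assms by (simp add: lower_transition_rate_operator_def le_fun_def)
  \<comment> \<open>Homogeneity covers nonnegative factors only, so the indicator and its negative
    have to be bounded separately.\<close>
  define b where "b y = max_norm (Q (indicator {y})) + max_norm (Q (\<lambda>z. - indicator {y} z))" for y
  \<comment> \<open>The summand 1 makes \<open>K\<close> strictly positive, so that
    \<open>1 / K\<close> can serve as a bound on step lengths.\<close>
  define K where "K = 1 + (\<Sum>y\<in>UNIV. b y)"
  have b: "0 \<le> b y" for y
    by (simp add: b_def max_norm_nonneg)
  then show "K > 0"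
    by (simp add: K_def add_pos_nonneg sum_nonneg)
  have lower: "- (K * max_norm h) \<le> Q h x" for h x
  proof -
    have "- (max_norm h * b y) \<le> Q (\<lambda>z. h y * indicator {y} z) x" for y
    proof -
      \<comment> \<open>Here \<open>e\<close> is the value of \<open>Q\<close> at the indicator
        carrying the sign of \<open>h y\<close>, once the factor \<open>\<bar>h y\<bar>\<close> has
        been pulled out.\<close>
      have "\<exists>e. \<bar>e\<bar> \<le> b y \<and> Q (\<lambda>z. h y * indicator {y} z) x = \<bar>h y\<bar> * e"
      proof (cases "0 \<le> h y")
        case True
        then show ?thesis
          using hom[of "h y" "indicator {y}" x] abs_le_max_norm[of "Q (indicator {y})" x]
            max_norm_nonneg[of "Q (\<lambda>z. - indicator {y} z)"]
          by (intro exI[of _ "Q (indicator {y}) x"]) (auto simp: b_def)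
      next
        case False
        then show ?thesis
          using hom[of "- h y" "\<lambda>z. - indicator {y} z" x]
            abs_le_max_norm[of "Q (\<lambda>z. - indicator {y} z)" x]
            max_norm_nonneg[of "Q (indicator {y})"]
          by (intro exI[of _ "Q (\<lambda>z. - indicator {y} z) x"]) (auto simp: b_def)
      qed
      then obtain e where e: "\<bar>e\<bar> \<le> b y" "Q (\<lambda>z. h y * indicator {y} z) x = \<bar>h y\<bar> * e"
        by blast
      have "\<bar>h y\<bar> * \<bar>e\<bar> \<le> max_norm h * b y"
        using e(1) by (intro mult_mono abs_le_max_norm max_norm_nonneg) auto
      then show ?thesis
        unfolding e(2) using abs_ge_minus_self[of "\<bar>h y\<bar> * e"] by (simp add: abs_mult)
    qed
    then have "(\<Sum>y\<in>UNIV. - (max_norm h * b y)) \<le> (\<Sum>y\<in>UNIV. Q (\<lambda>z. h y * indicator {y} z) x)"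
      by (intro sum_mono)
    also have "\<dots> \<le> Q h x"
      by (rule lower_transition_rate_operator_indicator_sum[OF assms])
    finally show ?thesis
      using max_norm_nonneg[of h]
      by (simp add: K_def sum_negf sum_distrib_left algebra_simps)
  qed
  show "max_norm (\<lambda>x. Q f x - Q g x) \<le> K * max_norm (\<lambda>x. f x - g x)" for f g
    unfolding max_norm_le_iff
  proof
    fix x
    show "\<bar>Q f x - Q g x\<bar> \<le> K * max_norm (\<lambda>x. f x - g x)"
      using super[of g x "\<lambda>x. f x - g x"] super[of f x "\<lambda>x. g x - f x"]
        lower[of "\<lambda>x. f x - g x" x] lower[of "\<lambda>x. g x - f x" x]
      by (simp add: max_norm_minus_commute[of g f])
  qed
qed

text \<open>Fixing one Lipschitz constant lets every smallness condition on steps take the form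
  \<open>d * K \<le> 1\<close>.\<close>

locale Lipschitz_rate_operator =
  fixes Q :: "'x::finite operator" and K :: real
  assumes rate: "lower_transition_rate_operator Q"
    and K_pos: "K > 0"
    and lipschitz: "max_norm (\<lambda>x. Q f x - Q g x) \<le> K * max_norm (\<lambda>x. f x - g x)"
begin

lemma const: "Q (\<lambda>_. c) x = 0"
  using rate by (simp add: lower_transition_rate_operator_def)

lemma superadditive: "Q f x + Q g x \<le> Q (\<lambda>x. f x + g x) x"
  using rate by (simp add: lower_transition_rate_operator_def le_fun_def)

lemma homogeneous: "0 \<le> c \<Longrightarrow> Q (\<lambda>x. c * f x) = (\<lambda>x. c * Q f x)"
  using rate by (simp add: lower_transition_rate_operator_def)

lemma bounded: "max_norm (Q f) \<le> K * max_norm f"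
  using lipschitz[of f "\<lambda>_. 0"] by (simp add: const)

lemma nonneg_diagonal:
  assumes "\<And>y. 0 \<le> g y"
  shows "g x * Q (indicator {x}) x \<le> Q g x"
proof -
  have "0 \<le> Q (indicator {y}) x" if "x \<noteq> y" for y
    using rate that by (simp add: lower_transition_rate_operator_def)
  then have "(if y = x then g x * Q (indicator {x}) x else 0) \<le> Q (\<lambda>z. g y * indicator {y} z) x" for y
    using assms homogeneous[of "g y" "indicator {y}"] by auto
  then have "(\<Sum>y\<in>UNIV. if y = x then g x * Q (indicator {x}) x else 0) \<le>
    (\<Sum>y\<in>UNIV. Q (\<lambda>z. g y * indicator {y} z) x)"
    by (rule sum_mono)
  also have "\<dots> \<le> Q g x"
    by (rule lower_transition_rate_operator_indicator_sum[OF rate])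
  finally show ?thesis
    by simp
qed

text \<open>For the lower bound, subtract the minimum \<open>m\<close> and apply
  \<open>nonneg_diagonal\<close>. What remains is
  \<open>(f x - m) * (1 + d * Q (indicator {x}) x) \<ge> 0\<close>, which holds because the diagonal
  rate is at least \<open>- K\<close> and \<open>d * K \<le> 1\<close>.\<close>

lemma lower_transition_operator_Euler_step:
  assumes "0 \<le> d" "d * K \<le> 1"
  shows "lower_transition_operator (Euler_step Q d)"
  unfolding lower_transition_operator_def le_fun_def Euler_step_def
proof (intro conjI allI impI)
  fix f g :: "'x \<Rightarrow> real" and x :: 'x
  define m where "m = Min (range f)"
  have m: "m \<le> f y" for y
    by (simp add: m_def)
  have "max_norm (indicator {x}) \<le> 1"
    by (simp add: max_norm_le_iff indicator_def)
  then have "K * max_norm (indicator {x}) \<le> K"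
    using K_pos by simp
  then have "- K \<le> Q (indicator {x}) x"
    using abs_le_max_norm[of "Q (indicator {x})" x] bounded[of "indicator {x}"] by linarith
  then have "- 1 \<le> d * Q (indicator {x}) x"
    using assms mult_left_mono[of "- K" "Q (indicator {x}) x" d] by linarith
  then have "0 \<le> (f x - m) * (1 + d * Q (indicator {x}) x)"
    using m[of x] by (intro mult_nonneg_nonneg) auto
  \<comment> \<open>Since \<open>Q\<close> vanishes on constants, adding \<open>m\<close> back gives
    \<open>Q (f - m) \<le> Q f\<close>.\<close>
  moreover have "(f x - m) * Q (indicator {x}) x \<le> Q f x"
    using nonneg_diagonal[of "\<lambda>y. f y - m" x] superadditive[of "\<lambda>y. f y - m" x "\<lambda>_. m"] m
    by (simp add: const)
  then have "d * ((f x - m) * Q (indicator {x}) x) \<le> d * Q f x"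
    using assms(1) by (rule mult_left_mono)
  ultimately show "Min (range f) \<le> f x + d * Q f x"
    unfolding m_def[symmetric] by (simp add: algebra_simps)
  show "f x + d * Q f x + (g x + d * Q g x) \<le> f x + g x + d * Q (\<lambda>x. f x + g x) x"
    using mult_left_mono[OF superadditive[of f x g] assms(1)] by (simp add: algebra_simps)
next
  fix c :: real and f :: "'x \<Rightarrow> real"
  assume "0 \<le> c"
  then show "(\<lambda>x. c * f x + d * Q (\<lambda>x. c * f x) x) = (\<lambda>x. c * (f x + d * Q f x))"
    by (simp add: homogeneous algebra_simps)
qed

lemma Euler_product_homogeneous:
  assumes "0 \<le> c"
  shows "Euler_product Q u (\<lambda>x. c * f x) = (\<lambda>x. c * Euler_product Q u f x)"
proof -
  have "foldr (\<lambda>d A. Euler_step Q d \<circ> A) ds id (\<lambda>x. c * f x) =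
    (\<lambda>x. c * foldr (\<lambda>d A. Euler_step Q d \<circ> A) ds id f x)" for ds
    by (induction ds) (simp_all add: Euler_step_def homogeneous[OF assms] algebra_simps)
  then show ?thesis
    by (simp add: Euler_product_def)
qed

lemma mesh_mono_K: "a \<le> b \<Longrightarrow> b * K \<le> 1 \<Longrightarrow> a * K \<le> 1"
  using mult_right_mono[of a b K] K_pos by linarith

lemma lower_transition_operator_Euler_product:
  assumes "u \<in> subdivisions t s" "mesh u * K \<le> 1"
  shows "lower_transition_operator (Euler_product Q u)"
  using assms
proof (induction rule: subdivisions_induct)
  case single
  show ?case
    unfolding Euler_product_single by (rule lower_transition_operator_id)
next
  case (step t r u)
  then have "(r - t) * K \<le> 1" "mesh u * K \<le> 1"
    using mesh_mono_K[OF _ step.prems] by (auto simp: mesh_Cons)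
  then show ?case
    unfolding Euler_product_Cons[OF step.hyps(2)] using step
    by (intro lower_transition_operator_comp lower_transition_operator_Euler_step) auto
qed

section \<open>Comparison of Euler products\<close>

text \<open>Each factor contributes its length times \<open>Q g\<close>, where \<open>g\<close> is
  the product of the remaining factors applied to \<open>f\<close>. That product does not increase
  the norm, so the contributions add up linearly in \<open>s - t\<close>.\<close>

lemma Euler_product_minus_id:
  assumes "u \<in> subdivisions t s" "mesh u * K \<le> 1"
  shows "max_norm (\<lambda>x. Euler_product Q u f x - f x) \<le> K * (s - t) * max_norm f"
  using assms
proof (induction rule: subdivisions_induct)
  case single
  then show ?case
    by simp
next
  case (step t r u)
  define g where "g = Euler_product Q u f"
  have mesh: "mesh u * K \<le> 1"
    using mesh_mono_K[OF _ step.prems] step.hyps by (auto simp: mesh_Cons)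
  have "max_norm g \<le> max_norm f"
    unfolding g_def by (rule lower_transition_operator_max_norm_le)
      (rule lower_transition_operator_Euler_product[OF step.hyps(2) mesh])
  then have "max_norm (Q g) \<le> K * max_norm f"
    using bounded[of g] mult_left_mono[of "max_norm g" "max_norm f" K] K_pos by linarith
  then have "(r - t) * max_norm (Q g) \<le> (r - t) * (K * max_norm f)"
    using step.hyps(1) by simp
  moreover have "max_norm (\<lambda>x. (g x - f x) + (r - t) * Q g x) \<le>
    max_norm (\<lambda>x. g x - f x) + (r - t) * max_norm (Q g)"
    using max_norm_add_le[of "\<lambda>x. g x - f x" "\<lambda>x. (r - t) * Q g x"] step.hyps(1)
    by (simp add: max_norm_scale)
  moreover have "max_norm (\<lambda>x. g x - f x) \<le> K * (s - r) * max_norm f"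
    unfolding g_def by (rule step.IH[OF mesh])
  moreover have "(\<lambda>x. Euler_product Q (t # u) f x - f x) = (\<lambda>x. (g x - f x) + (r - t) * Q g x)"
    by (simp add: Euler_product_Cons[OF step.hyps(2)] Euler_step_def g_def algebra_simps)
  moreover have "K * (s - r) * max_norm f + (r - t) * (K * max_norm f) = K * (s - t) * max_norm f"
    by (simp add: algebra_simps)
  ultimately show ?case
    by simp
qed

text \<open>The local error: merging all steps into one replaces \<open>Q g\<close> by
  \<open>Q f\<close> in each step. By the Lipschitz bound and \<open>Euler_product_minus_id\<close>
  this costs first order in the remaining length, hence second order after multiplication by the
  step.\<close>

lemma Euler_product_minus_Euler_step:
  assumes "u \<in> subdivisions t s" "mesh u * K \<le> 1"
  shows "max_norm (\<lambda>x. Euler_product Q u f x - Euler_step Q (s - t) f x)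
    \<le> K\<^sup>2 * (s - t)\<^sup>2 * max_norm f"
  using assms
proof (induction rule: subdivisions_induct)
  case single
  then show ?case
    by (simp add: Euler_step_def)
next
  case (step t r u)
  define g where "g = Euler_product Q u f"
  define h where "h = Euler_step Q (s - r) f"
  have mesh: "mesh u * K \<le> 1"
    using mesh_mono_K[OF _ step.prems] step.hyps by (auto simp: mesh_Cons)
  have rs: "r \<le> s"
    using step.hyps(2) by (rule subdivisions_le)
  have "max_norm (\<lambda>x. g x - f x) \<le> K * (s - r) * max_norm f"
    unfolding g_def by (rule Euler_product_minus_id[OF step.hyps(2) mesh])
  then have "K * max_norm (\<lambda>x. g x - f x) \<le> K * (K * (s - r) * max_norm f)"
    using K_pos by simp
  then have "max_norm (\<lambda>x. Q g x - Q f x) \<le> K\<^sup>2 * (s - r) * max_norm f"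
    using lipschitz[of g f] by (simp add: power2_eq_square mult.assoc)
  then have "(r - t) * max_norm (\<lambda>x. Q g x - Q f x) \<le> (r - t) * (K\<^sup>2 * (s - r) * max_norm f)"
    using step.hyps(1) by simp
  moreover have "max_norm (\<lambda>x. (g x - h x) + (r - t) * (Q g x - Q f x)) \<le>
    max_norm (\<lambda>x. g x - h x) + (r - t) * max_norm (\<lambda>x. Q g x - Q f x)"
    using max_norm_add_le[of "\<lambda>x. g x - h x" "\<lambda>x. (r - t) * (Q g x - Q f x)"] step.hyps(1)
      max_norm_scale[of "r - t" "\<lambda>x. Q g x - Q f x"]
    by simp
  moreover have "max_norm (\<lambda>x. g x - h x) \<le> K\<^sup>2 * (s - r)\<^sup>2 * max_norm f"
    unfolding g_def h_def by (rule step.IH[OF mesh])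
  \<comment> \<open>The long step is split as
    \<open>(s - t) * Q f = (s - r) * Q f + (r - t) * Q f\<close>; the first part is absorbed in
    \<open>h\<close>.\<close>
  moreover have "(\<lambda>x. Euler_product Q (t # u) f x - Euler_step Q (s - t) f x) =
    (\<lambda>x. (g x - h x) + (r - t) * (Q g x - Q f x))"
    using step.hyps
    by (simp add: Euler_product_Cons Euler_step_def g_def h_def algebra_simps)
  ultimately have "max_norm (\<lambda>x. Euler_product Q (t # u) f x - Euler_step Q (s - t) f x) \<le>
    K\<^sup>2 * max_norm f * ((s - r)\<^sup>2 + (r - t) * (s - r))"
    by (simp add: algebra_simps)
  also have "\<dots> \<le> K\<^sup>2 * max_norm f * (s - t)\<^sup>2"
  proof (rule mult_left_mono)
    have "(s - t)\<^sup>2 = (s - r)\<^sup>2 + (r - t) * (s - r) + (r - t) * (s - t)"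
      by (simp add: power2_eq_square algebra_simps)
    moreover have "0 \<le> (r - t) * (s - t)"
      using rs step.hyps(1) by simp
    ultimately show "(s - r)\<^sup>2 + (r - t) * (s - r) \<le> (s - t)\<^sup>2"
      by linarith
  qed (simp add: max_norm_nonneg)
  finally show ?case
    by (simp add: mult.commute mult.left_commute)
qed

text \<open>Over the first coarse step the error is local; over the rest it comes from the induction
  and passes undiminished at worst through a nonexpansive Euler step. The bound \<delta> is separate
  from \<open>mesh u\<close> so that it stays fixed when the tail has a smaller mesh. The mesh claim
  is part of the induction because it makes the product over the refined tail a lower transition
  operator.\<close>

lemma Euler_product_refinement:
  assumes "u \<in> subdivisions t s" "w \<in> subdivisions t s" "set u \<subseteq> set w"
    and "mesh u \<le> \<delta>" "\<delta> * K \<le> 1"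
  shows "mesh w \<le> \<delta> \<and>
    max_norm (\<lambda>x. Euler_product Q u f x - Euler_product Q w f x) \<le> K\<^sup>2 * \<delta> * (s - t) * max_norm f"
  using assms(1-4)
proof (induction arbitrary: w rule: subdivisions_induct)
  case single
  then show ?case
    by (simp add: subdivisions_same)
next
  case (step t r u)
  have "r \<in> set w"
    using step.prems(2) subdivisions_set[OF step.hyps(2)] by auto
  then obtain w1 w2 where w: "w1 \<in> subdivisions t r" "w2 \<in> subdivisions r s"
    "w = butlast w1 @ w2" "{x \<in> set w. r \<le> x} = set w2"
    using subdivisions_split[OF step.prems(1)] by metis
  have \<delta>: "r - t \<le> \<delta>" "mesh u \<le> \<delta>"
    using step.prems(3) step.hyps by (auto simp: mesh_Cons)
  have "set u \<subseteq> set w2"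
    using w(4) step.prems(2) subdivisions_set[OF step.hyps(2)] by force
  then have IH: "mesh w2 \<le> \<delta>"
    "max_norm (\<lambda>x. Euler_product Q u f x - Euler_product Q w2 f x) \<le> K\<^sup>2 * \<delta> * (s - r) * max_norm f"
    using step.IH[OF w(2)] \<delta>(2) by auto
  have mesh1: "mesh w1 \<le> \<delta>"
    using mesh_le_length[OF w(1)] \<delta>(1) by linarith
  define g where "g = Euler_product Q w2 f"
  define h where "h = Euler_product Q u f"
  have "max_norm g \<le> max_norm f"
    unfolding g_def using IH(1) assms(5)
    by (intro lower_transition_operator_max_norm_le lower_transition_operator_Euler_product[OF w(2)])
      (rule mesh_mono_K)
  have "max_norm (\<lambda>x. Euler_product Q w1 g x - Euler_step Q (r - t) g x) \<le> K\<^sup>2 * (r - t)\<^sup>2 * max_norm g"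
    using mesh1 assms(5) by (intro Euler_product_minus_Euler_step[OF w(1)]) (rule mesh_mono_K)
  \<comment> \<open>One factor \<open>r - t\<close> is traded for \<delta>, so that the local errors
    sum to a multiple of \<open>s - t\<close>.\<close>
  also have "\<dots> \<le> K\<^sup>2 * (\<delta> * (r - t)) * max_norm f"
    using \<delta>(1) step.hyps(1) \<open>max_norm g \<le> max_norm f\<close> max_norm_nonneg[of g]
    by (intro mult_mono) (auto simp: power2_eq_square)
  finally have "max_norm (\<lambda>x. Euler_step Q (r - t) g x - Euler_product Q w1 g x)
    \<le> K\<^sup>2 * (\<delta> * (r - t)) * max_norm f"
    by (simp add: max_norm_minus_commute[of "Euler_step Q (r - t) g"])
  moreover have "max_norm (\<lambda>x. Euler_step Q (r - t) h x - Euler_step Q (r - t) g x) \<le>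
    max_norm (\<lambda>x. h x - g x)"
    using step.hyps(1) mesh_mono_K[OF \<delta>(1) assms(5)]
    by (intro lower_transition_operator_nonexpansive lower_transition_operator_Euler_step) auto
  ultimately have "max_norm (\<lambda>x. Euler_step Q (r - t) h x - Euler_product Q w1 g x)
    \<le> K\<^sup>2 * \<delta> * (s - t) * max_norm f"
    using IH(2) max_norm_triangle[of "Euler_step Q (r - t) h" "Euler_product Q w1 g" "Euler_step Q (r - t) g"]
    by (simp add: g_def[symmetric] h_def[symmetric] algebra_simps)
  then show ?case
    using IH(1) mesh1 step.hyps
    by (simp add: w(3) subdivisions_join(2,3)[OF w(1,2)] Euler_product_Cons g_def h_def)
qed

text \<open>Both products are compared with the one over a common refinement. This is the Cauchy
  estimate behind existence.\<close>

lemma Euler_product_diff: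
  assumes "u \<in> subdivisions t s" "v \<in> subdivisions t s" "mesh u * K \<le> 1" "mesh v * K \<le> 1"
  shows "max_norm (\<lambda>x. Euler_product Q u f x - Euler_product Q v f x)
    \<le> K\<^sup>2 * (s - t) * max_norm f * (mesh u + mesh v)"
proof -
  obtain w where w: "w \<in> subdivisions t s" "set u \<subseteq> set w" "set v \<subseteq> set w"
    using subdivisions_common_refinement[OF assms(1,2)] .
  show ?thesis
    using Euler_product_refinement[OF assms(1) w(1,2) order_refl assms(3), of f]
      Euler_product_refinement[OF assms(2) w(1,3) order_refl assms(4), of f]
      max_norm_triangle[of "Euler_product Q u f" "Euler_product Q v f" "Euler_product Q w f"]
      max_norm_minus_commute[of "Euler_product Q v f" "Euler_product Q w f"]
    by (simp add: algebra_simps)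
qed

section \<open>The corresponding lower transition operator\<close>

text \<open>The difference of \<open>T\<close> and an Euler product is homogeneous, so
  \<open>operator_norm_le_iff\<close> applies.\<close>

lemma corresponds_iff:
  "corresponds Q t s T \<longleftrightarrow> lower_transition_operator T \<and>
     (\<forall>\<epsilon>>0. \<exists>\<delta>>0. \<forall>u\<in>subdivisions t s. mesh u \<le> \<delta> \<longrightarrow>
        (\<forall>f. max_norm (\<lambda>x. T f x - Euler_product Q u f x) \<le> \<epsilon> * max_norm f))"
proof -
  have "operator_norm (\<lambda>f x. T f x - Euler_product Q u f x) \<le> ereal \<epsilon> \<longleftrightarrow>
    (\<forall>f. max_norm (\<lambda>x. T f x - Euler_product Q u f x) \<le> \<epsilon> * max_norm f)"
    if "lower_transition_operator T" for u \<epsilon>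
    by (rule operator_norm_le_iff)
      (simp add: lower_transition_operator_homogeneous[OF that] Euler_product_homogeneous algebra_simps)
  then show ?thesis
    unfolding corresponds_def by auto
qed

lemma corresponds_exists:
  assumes "t \<le> s"
  shows "\<exists>T. corresponds Q t s T"
proof -
  \<comment> \<open>A null sequence bounded by \<open>1 / K\<close>, so that every product along
    \<open>u n\<close> is already a lower transition operator.\<close>
  define \<delta> where "\<delta> n = inverse K * inverse (real (Suc n))" for n
  have \<delta>_pos: "\<delta> n > 0" for n
    using K_pos by (simp add: \<delta>_def)
  have \<delta>_le: "\<delta> n * K \<le> 1" for n
  proof -
    have "\<delta> n * K = inverse (real (Suc n))"
      using K_pos by (simp add: \<delta>_def)
    also have "\<dots> \<le> 1"
      by (simp add: inverse_le_1_iff)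
    finally show ?thesis .
  qed
  have "\<exists>u. u \<in> subdivisions t s \<and> mesh u \<le> \<delta> n" for n
    using subdivisions_fine[OF assms \<delta>_pos] by blast
  then obtain u where u: "\<And>n. u n \<in> subdivisions t s" "\<And>n. mesh (u n) \<le> \<delta> n"
    by metis
  have uK: "mesh (u n) * K \<le> 1" for n
    using mesh_mono_K[OF u(2) \<delta>_le] .
  have "\<delta> \<longlonglongrightarrow> inverse K * 0"
    unfolding \<delta>_def by (intro tendsto_mult tendsto_const LIMSEQ_inverse_real_of_nat)
  then have mesh_0: "(\<lambda>n. mesh (u n)) \<longlonglongrightarrow> 0"
    using tendsto_sandwich[of "\<lambda>_. 0" "\<lambda>n. mesh (u n)" sequentially \<delta> 0] u(2) mesh_nonneg by simp
  define C where "C f = K\<^sup>2 * (s - t) * max_norm f" for f :: "'x \<Rightarrow> real"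
  have C: "C f \<ge> 0" for f
    using assms by (simp add: C_def max_norm_nonneg)
  have diff: "\<bar>Euler_product Q v f x - Euler_product Q (u n) f x\<bar> \<le> C f * (mesh v + mesh (u n))"
    if "v \<in> subdivisions t s" "mesh v * K \<le> 1" for v f x n
    using Euler_product_diff[OF that(1) u(1) that(2) uK, of f n]
    unfolding max_norm_le_iff C_def by blast
  have "Cauchy (\<lambda>n. Euler_product Q (u n) f x)" for f x
  proof (rule metric_CauchyI)
    fix e :: real
    assume "e > 0"
    have "(\<lambda>n. C f * mesh (u n)) \<longlonglongrightarrow> C f * 0"
      by (intro tendsto_mult tendsto_const mesh_0)
    then have "\<forall>\<^sub>F n in sequentially. C f * mesh (u n) < e / 2"
      using \<open>e > 0\<close> by (intro order_tendstoD(2)) auto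
    then obtain N where N: "\<And>n. n \<ge> N \<Longrightarrow> C f * mesh (u n) < e / 2"
      unfolding eventually_sequentially by blast
    have "dist (Euler_product Q (u m) f x) (Euler_product Q (u n) f x) < e" if "m \<ge> N" "n \<ge> N" for m n
      using diff[OF u(1) uK, of m f x n] N[OF that(1)] N[OF that(2)]
      by (simp add: dist_real_def algebra_simps)
    then show "\<exists>M. \<forall>m\<ge>M. \<forall>n\<ge>M. dist (Euler_product Q (u m) f x) (Euler_product Q (u n) f x) < e"
      by blast
  qed
  then have "convergent (\<lambda>n. Euler_product Q (u n) f x)" for f x
    by (rule Cauchy_convergent)
  then obtain T where T: "\<And>f x. (\<lambda>n. Euler_product Q (u n) f x) \<longlonglongrightarrow> T f x"
    unfolding convergent_def by metis
  have lto: "lower_transition_operator (Euler_product Q (u n))" for n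
    by (rule lower_transition_operator_Euler_product[OF u(1) uK])
  have "lower_transition_operator T"
    unfolding lower_transition_operator_def le_fun_def
  proof (intro conjI allI impI)
    fix f g x
    show "Min (range f) \<le> T f x"
      using lower_transition_operator_ge[OF lto, of "Min (range f)" f]
      by (intro LIMSEQ_le_const[OF T]) auto
    show "T f x + T g x \<le> T (\<lambda>x. f x + g x) x"
      using lower_transition_operator_superadditive[OF lto]
      by (intro LIMSEQ_le[OF tendsto_add[OF T T] T]) auto
  next
    fix c :: real and f
    assume c: "0 \<le> c"
    show "T (\<lambda>x. c * f x) = (\<lambda>x. c * T f x)"
    proof
      fix x
      show "T (\<lambda>x. c * f x) x = c * T f x"
        using T[of "\<lambda>x. c * f x" x] tendsto_mult[OF tendsto_const T, of c f x]
        unfolding lower_transition_operator_homogeneous[OF lto c] by (rule LIMSEQ_unique)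
    qed
  qed
  \<comment> \<open>Letting \<open>n\<close> tend to infinity in \<open>diff\<close> with
    \<open>v\<close> fixed gives a bound uniform over all fine subdivisions, not merely along the
    chosen sequence.\<close>
  moreover have "max_norm (\<lambda>x. T f x - Euler_product Q v f x) \<le> C f * mesh v"
    if "v \<in> subdivisions t s" "mesh v * K \<le> 1" for v f
    unfolding max_norm_le_iff
  proof
    fix x
    have "(\<lambda>n. \<bar>Euler_product Q v f x - Euler_product Q (u n) f x\<bar>) \<longlonglongrightarrow> \<bar>Euler_product Q v f x - T f x\<bar>"
      by (intro tendsto_intros T)
    moreover have "(\<lambda>n. C f * (mesh v + mesh (u n))) \<longlonglongrightarrow> C f * (mesh v + 0)"
      by (intro tendsto_intros mesh_0)
    ultimately have "\<bar>Euler_product Q v f x - T f x\<bar> \<le> C f * (mesh v + 0)"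
      using diff[OF that] by (intro LIMSEQ_le) auto
    then show "\<bar>T f x - Euler_product Q v f x\<bar> \<le> C f * mesh v"
      by (simp add: abs_minus_commute)
  qed
  \<comment> \<open>Here \<open>r\<close> stands for a mesh. The threshold \<open>1 / K\<close>
    makes the estimate applicable and the other one makes the error small; the 1 in its denominator
    covers \<open>t = s\<close>.\<close>
  moreover have "\<exists>d>0. \<forall>r. r \<le> d \<longrightarrow> r * K \<le> 1 \<and> (\<forall>f. C f * r \<le> \<epsilon> * max_norm f)" if "\<epsilon> > 0" for \<epsilon>
  proof (intro exI[of _ "min (1 / K) (\<epsilon> / (1 + K\<^sup>2 * (s - t)))"] conjI allI impI)
    have B: "0 \<le> K\<^sup>2 * (s - t)"
      using assms by simp
    then show "0 < min (1 / K) (\<epsilon> / (1 + K\<^sup>2 * (s - t)))"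
      using K_pos that by (simp add: add_pos_nonneg)
    fix r and f :: "'x \<Rightarrow> real"
    assume r: "r \<le> min (1 / K) (\<epsilon> / (1 + K\<^sup>2 * (s - t)))"
    then show "r * K \<le> 1"
      using K_pos by (simp add: field_simps)
    have "K\<^sup>2 * (s - t) * r \<le> K\<^sup>2 * (s - t) * (\<epsilon> / (1 + K\<^sup>2 * (s - t)))"
      using r B by (intro mult_left_mono) auto
    also have "\<dots> \<le> \<epsilon>"
      using B that by (simp add: divide_simps algebra_simps)
    finally have "K\<^sup>2 * (s - t) * r * max_norm f \<le> \<epsilon> * max_norm f"
      by (intro mult_right_mono max_norm_nonneg)
    then show "C f * r \<le> \<epsilon> * max_norm f"
      by (simp add: C_def mult_ac)
  qed
  ultimately show ?thesis
    unfolding corresponds_iff by (meson order_trans)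
qed

text \<open>It is enough that \<open>S\<close> be approximated along some arbitrarily fine
  subdivisions, since \<open>T\<close> is close to the products along all fine ones. This form lets
  the semigroup proof choose subdivisions through the intermediate point.\<close>

lemma corresponds_unique:
  assumes "t \<le> s" "corresponds Q t s T"
    and approx: "\<And>\<epsilon> \<delta>. \<epsilon> > 0 \<Longrightarrow> \<delta> > 0 \<Longrightarrow> \<exists>u\<in>subdivisions t s. mesh u \<le> \<delta> \<and>
      (\<forall>f. max_norm (\<lambda>x. S f x - Euler_product Q u f x) \<le> \<epsilon> * max_norm f)"
  shows "T = S"
proof -
  have "max_norm (\<lambda>x. T f x - S f x) \<le> 0 + e" if "e > 0" for f e
  proof -
    \<comment> \<open>Two errors of size \<open>\<epsilon> * max_norm f\<close> must total at most
      \<open>e\<close>; the 1 covers \<open>f = 0\<close>.\<close>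
    define \<epsilon> where "\<epsilon> = e / (2 * (1 + max_norm f))"
    have \<epsilon>: "\<epsilon> > 0"
      using that max_norm_nonneg[of f] by (simp add: \<epsilon>_def)
    obtain \<delta> where "\<delta> > 0" and \<delta>: "\<And>u. u \<in> subdivisions t s \<Longrightarrow> mesh u \<le> \<delta> \<Longrightarrow>
        max_norm (\<lambda>x. T f x - Euler_product Q u f x) \<le> \<epsilon> * max_norm f"
      using assms(2) \<epsilon> unfolding corresponds_iff by meson
    obtain u where u: "u \<in> subdivisions t s" "mesh u \<le> \<delta>"
      "max_norm (\<lambda>x. S f x - Euler_product Q u f x) \<le> \<epsilon> * max_norm f"
      using approx[OF \<epsilon> \<open>\<delta> > 0\<close>] by blast
    have "max_norm (\<lambda>x. T f x - S f x) \<le> 2 * (\<epsilon> * max_norm f)"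
      using max_norm_triangle[of "T f" "S f" "Euler_product Q u f"] \<delta>[OF u(1,2)] u(3)
      by (simp add: max_norm_minus_commute[of "S f"])
    also have "\<dots> \<le> e"
      using that max_norm_nonneg[of f] by (simp add: \<epsilon>_def divide_simps algebra_simps)
    finally show ?thesis
      by simp
  qed
  then have "max_norm (\<lambda>x. T f x - S f x) \<le> 0" for f
    by (meson field_le_epsilon)
  then show ?thesis
    by (simp add: max_norm_le_iff fun_eq_iff)
qed

text \<open>Existence and uniqueness make the definite description proper.\<close>

lemma corresponds_lower_transition:
  assumes "t \<le> s"
  shows "corresponds Q t s (lower_transition Q t s)"
proof -
  obtain T where T: "corresponds Q t s T"
    using corresponds_exists[OF assms] by blast
  have "S = T" if S: "corresponds Q t s S" for S
  proof (rule corresponds_unique[OF assms S])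
    fix \<epsilon> \<delta> :: real
    assume "\<epsilon> > 0" "\<delta> > 0"
    obtain d where d: "d > 0" "\<And>u. u \<in> subdivisions t s \<Longrightarrow> mesh u \<le> d \<Longrightarrow>
        (\<forall>f. max_norm (\<lambda>x. T f x - Euler_product Q u f x) \<le> \<epsilon> * max_norm f)"
      using T \<open>\<epsilon> > 0\<close> unfolding corresponds_iff by meson
    obtain u where "u \<in> subdivisions t s" "mesh u \<le> min d \<delta>"
      using subdivisions_fine[OF assms, of "min d \<delta>"] d(1) \<open>\<delta> > 0\<close> by auto
    then show "\<exists>u\<in>subdivisions t s. mesh u \<le> \<delta> \<and>
        (\<forall>f. max_norm (\<lambda>x. T f x - Euler_product Q u f x) \<le> \<epsilon> * max_norm f)"
      using d(2) by auto
  qed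
  then show ?thesis
    unfolding lower_transition_def using T by (rule theI[of "corresponds Q t s", rotated])
qed

lemma lower_transition_semigroup:
  assumes "t \<le> r" "r \<le> s"
  shows "lower_transition Q t s = lower_transition Q t r \<circ> lower_transition Q r s"
proof (rule corresponds_unique)
  show "t \<le> s"
    using assms by simp
  then show "corresponds Q t s (lower_transition Q t s)"
    by (rule corresponds_lower_transition)
next
  fix \<epsilon> \<delta> :: real
  assume pos: "\<epsilon> > 0" "\<delta> > 0"
  define A where "A = lower_transition Q t r"
  define B where "B = lower_transition Q r s"
  have A: "corresponds Q t r A" and B: "corresponds Q r s B"
    unfolding A_def B_def using assms corresponds_lower_transition by auto
  have "\<epsilon> / 2 > 0"
    using pos by simp
  then obtain d where d: "d > 0" "\<And>u f. u \<in> subdivisions t r \<Longrightarrow> mesh u \<le> d \<Longrightarrow>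
      max_norm (\<lambda>x. A f x - Euler_product Q u f x) \<le> \<epsilon> / 2 * max_norm f"
    using A unfolding corresponds_iff by meson
  obtain d' where d': "d' > 0" "\<And>u f. u \<in> subdivisions r s \<Longrightarrow> mesh u \<le> d' \<Longrightarrow>
      max_norm (\<lambda>x. B f x - Euler_product Q u f x) \<le> \<epsilon> / 2 * max_norm f"
    using B \<open>\<epsilon> / 2 > 0\<close> unfolding corresponds_iff by meson
  \<comment> \<open>The bounds \<open>d\<close> and \<open>d'\<close> give the two approximations,
    \<delta> the requested mesh, and \<open>1 / K\<close> the nonexpansiveness of the product over
    \<open>v\<close>.\<close>
  define \<eta> where "\<eta> = Min {d, d', \<delta>, 1 / K}"
  have \<eta>: "\<eta> > 0" "\<eta> \<le> d" "\<eta> \<le> d'" "\<eta> \<le> \<delta>" "\<eta> \<le> 1 / K"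
    using d(1) d'(1) pos(2) K_pos by (auto simp: \<eta>_def)
  obtain u where u: "u \<in> subdivisions t r" "mesh u \<le> \<eta>"
    using subdivisions_fine[OF assms(1) \<eta>(1)] .
  obtain v where v: "v \<in> subdivisions r s" "mesh v \<le> \<eta>"
    using subdivisions_fine[OF assms(2) \<eta>(1)] .
  have "mesh v * K \<le> 1"
    using v(2) \<eta>(5) by (intro mesh_mono_K[of "mesh v" "1 / K"]) (use K_pos in auto)
  then have nonexp: "max_norm (Euler_product Q v f) \<le> max_norm f" for f
    by (intro lower_transition_operator_max_norm_le lower_transition_operator_Euler_product[OF v(1)])
  have "max_norm (\<lambda>x. (A \<circ> B) f x - Euler_product Q (butlast u @ v) f x) \<le> \<epsilon> * max_norm f" for f
  proof -
    define g where "g = Euler_product Q v f"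
    \<comment> \<open>The two operators are replaced one at a time: first \<open>B\<close> inside
      the nonexpansive \<open>A\<close>, then \<open>A\<close> at the function \<open>g\<close>,
      whose norm is at most that of \<open>f\<close>.\<close>
    have "max_norm (\<lambda>x. A (B f) x - A g x) \<le> max_norm (\<lambda>x. B f x - g x)"
      using A unfolding corresponds_iff by (blast intro: lower_transition_operator_nonexpansive)
    also have "\<dots> \<le> \<epsilon> / 2 * max_norm f"
      unfolding g_def using v \<eta> by (intro d'(2)) auto
    finally have 1: "max_norm (\<lambda>x. A (B f) x - A g x) \<le> \<epsilon> / 2 * max_norm f" .
    have "max_norm (\<lambda>x. A g x - Euler_product Q u g x) \<le> \<epsilon> / 2 * max_norm g"
      using u \<eta> by (intro d(2)) auto
    also have "\<dots> \<le> \<epsilon> / 2 * max_norm f"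
      unfolding g_def using nonexp pos(1) by simp
    finally show ?thesis
      using 1 max_norm_triangle[of "A (B f)" "Euler_product Q u g" "A g"]
      by (simp add: subdivisions_join(3)[OF u(1) v(1)] g_def)
  qed
  moreover have "mesh (butlast u @ v) \<le> \<delta>"
    using u v \<eta> by (simp add: subdivisions_join(2)[OF u(1) v(1)])
  ultimately show "\<exists>u\<in>subdivisions t s. mesh u \<le> \<delta> \<and>
      (\<forall>f. max_norm (\<lambda>x. (lower_transition Q t r \<circ> lower_transition Q r s) f x
        - Euler_product Q u f x) \<le> \<epsilon> * max_norm f)"
    unfolding A_def B_def using subdivisions_join(1)[OF u(1) v(1)] by blast
qed

text \<open>The one-point subdivision has mesh 0 and product \<open>id\<close>, so it approximates
  \<open>id\<close> without error.\<close>

lemma lower_transition_refl: "lower_transition Q t t = id"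
proof (rule corresponds_unique[OF order_refl corresponds_lower_transition[OF order_refl]])
  fix \<epsilon> \<delta> :: real
  assume "\<epsilon> > 0" "\<delta> > 0"
  then show "\<exists>u\<in>subdivisions t t. mesh u \<le> \<delta> \<and>
      (\<forall>f. max_norm (\<lambda>x. id f x - Euler_product Q u f x) \<le> \<epsilon> * max_norm f)"
    by (intro bexI[OF _ subdivisions_single]) (simp add: max_norm_nonneg)
qed

end

theorem proposition7p13:
  fixes Q :: "'x::finite operator"
  assumes "lower_transition_rate_operator Q"
  shows "(\<forall>t r s. 0 \<le> t \<and> t \<le> r \<and> r \<le> s \<longrightarrow>
            lower_transition Q t s = lower_transition Q t r \<circ> lower_transition Q r s) \<and>
         (\<forall>t\<ge>0. lower_transition Q t t = id)"
proof -
  obtain K where "K > 0"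
    "\<And>f g. max_norm (\<lambda>x. Q f x - Q g x) \<le> K * max_norm (\<lambda>x. f x - g x)"
    using lower_transition_rate_operator_lipschitz[OF assms] by blast
  then interpret Lipschitz_rate_operator Q K
    using assms by unfold_locales
  show ?thesis
    using lower_transition_semigroup lower_transition_refl by blast
qed

end
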